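(* Let $G$ be a finite simple connected walk-regular graph with diameter $D$, and let $h$ be an integer with $0\le h\le D$. The following statements are equivalent: (a) $G$ is $h$-punctually walk-regular. (b) $G$ is $h$-punctually spectrum-regular. (c) $G$ is $h$-punctually cospectral.
   Context: $\partial(u,v)$ denotes the distance between vertices $u,v$, and $\operatorname{sp}$ denotes the spectrum (eigenvalues with multiplicities) of the adjacency matrix. Let $A$ be the adjacency matrix of $G$, with distinct eigenvalues $\lambda_0>\lambda_1>\cdots>\lambda_d$, and let $E_i$ be the matrix of the orthogonal projection onto the eigenspace $\ker(\lambda_i I-A)$. $G$ is walk-regular if for every $\ell\ge 0$ the number $(A^\ell)_{uu}$ does not depend on the vertex $u$. For $0\le h\le D$: - $G$ is $h$-punctually walk-regular if for every $\ell\ge 0$ the number $(A^\ell)_{uv}$ of walks of length $\ell$ between $u$ and $v$ is the same for all pairs of vertices $u,v$ with $\partial(u,v)=h$. - $G$ is $h$-punctually spectrum-regular if for every $i=0,1,\dots,d$ the entry $(E_i)_{uv}$ is the same for all pairs of vertices $u,v$ with $\partial(u,v)=h$. - $G$ is $h$-punctually cospectral if $\operatorname{sp}(G-u-v)=\operatorname{sp}(G-w-z)$ for all pairs of vertices $u,v$ and $w,z$ with $\partial(u,v)=\partial(w,z)=h$. Here $G-u-v$ is the graph obtained from $G$ by removing the vertices in $\{u,v\}$ and all edges incident to them; when $h=0$ we have $u=v$ and this is $G-u$. *)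

theory Defs
  imports
    "Graph_Theory.Graph_Theory"
    "Jordan_Normal_Form.Spectral_Radius"
    "Jordan_Normal_Form.Matrix_Kernel"
    "HOL-Computational_Algebra.Polynomial"
begin

text \<open>
  A finite simple graph is a digraph satisfying the locale predicate \<^const>\<open>graph\<close>: finite,
  without loops or parallel arcs, and symmetric, each edge being a pair of opposite arcs.
\<close>

text \<open>The least number of arcs of a walk from \<open>u\<close> to \<open>v\<close> (infinite if there is none).\<close>

definition vdist :: "('a, 'b) pre_digraph \<Rightarrow> 'a \<Rightarrow> 'a \<Rightarrow> ereal" where
  "vdist G u v = wf_digraph.\<mu> G (\<lambda>_. 1) u v"

definition diam :: "('a, 'b) pre_digraph \<Rightarrow> ereal" where
  "diam G = (SUP u\<in>verts G. SUP v\<in>verts G. vdist G u v)"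

text \<open>
  Matrices of type \<^typ>\<open>real mat\<close> are indexed by \<open>0, \<dots>, n - 1\<close>, so we fix an enumeration of the
  vertices. Another choice conjugates the matrices below by a permutation matrix, which
  affects neither their entries \<open>entry G M u v\<close> nor their spectra.
\<close>

definition vert_list :: "('a, 'b) pre_digraph \<Rightarrow> 'a list" where
  "vert_list G = (SOME vs. distinct vs \<and> set vs = verts G)"

lemma vert_list:
  assumes "finite (verts G)"
  shows "distinct (vert_list G)" "set (vert_list G) = verts G"
    "length (vert_list G) = card (verts G)"
proof -
  from finite_distinct_list[OF assms] have "\<exists>vs. distinct vs \<and> set vs = verts G" by blast
  from someI_ex[OF this] show *: "distinct (vert_list G)" "set (vert_list G) = verts G"
    unfolding vert_list_def by auto
  show "length (vert_list G) = card (verts G)" using distinct_card[OF *(1)] *(2) by simp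
qed

definition vert_index :: "('a, 'b) pre_digraph \<Rightarrow> 'a \<Rightarrow> nat" where
  "vert_index G u = (THE i. i < length (vert_list G) \<and> vert_list G ! i = u)"

definition entry :: "('a, 'b) pre_digraph \<Rightarrow> real mat \<Rightarrow> 'a \<Rightarrow> 'a \<Rightarrow> real" where
  "entry G M u v = M $$ (vert_index G u, vert_index G v)"

definition adj_mat :: "('a, 'b) pre_digraph \<Rightarrow> real mat" where
  "adj_mat G = mat (card (verts G)) (card (verts G))
     (\<lambda>(i, j). if vert_list G ! i \<rightarrow>\<^bsub>G\<^esub> vert_list G ! j then 1 else 0)"

lemma entry_adj_mat:
  assumes "finite (verts G)" "u \<in> verts G" "v \<in> verts G"
  shows "entry G (adj_mat G) u v = (if u \<rightarrow>\<^bsub>G\<^esub> v then 1 else 0)"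
proof -
  have ix: "vert_index G w < card (verts G) \<and> vert_list G ! vert_index G w = w"
    if "w \<in> verts G" for w
  proof -
    have "\<exists>!i. i < length (vert_list G) \<and> vert_list G ! i = w"
      using vert_list[OF assms(1)] that by (metis distinct_Ex1)
    from theI'[OF this] show ?thesis
      unfolding vert_index_def using vert_list(3)[OF assms(1)] by simp
  qed
  show ?thesis using ix[OF assms(2)] ix[OF assms(3)] by (simp add: entry_def adj_mat_def)
qed

text \<open>
  The multiset of eigenvalues. The adjacency matrix of a graph is real symmetric, so all
  eigenvalues are real and their algebraic and geometric multiplicities agree.
\<close>

definition sp :: "('a, 'b) pre_digraph \<Rightarrow> real multiset" where
  "sp G = proots (char_poly (adj_mat G))"

definition orth_proj :: "nat \<Rightarrow> real vec set \<Rightarrow> real mat" where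
  "orth_proj n W = (THE E. E \<in> carrier_mat n n \<and>
     (\<forall>x\<in>carrier_vec n. E *\<^sub>v x \<in> W \<and> (\<forall>y\<in>W. (x - E *\<^sub>v x) \<bullet> y = 0)))"

definition eigenproj :: "('a, 'b) pre_digraph \<Rightarrow> real \<Rightarrow> real mat" where
  "eigenproj G l = orth_proj (card (verts G))
     (mat_kernel (l \<cdot>\<^sub>m 1\<^sub>m (card (verts G)) - adj_mat G))"

definition walk_regular :: "('a, 'b) pre_digraph \<Rightarrow> bool" where
  "walk_regular G \<longleftrightarrow>
     (\<forall>k. \<forall>u\<in>verts G. \<forall>v\<in>verts G.
        entry G (adj_mat G ^\<^sub>m k) u u = entry G (adj_mat G ^\<^sub>m k) v v)"

definition pairs_at_dist :: "('a, 'b) pre_digraph \<Rightarrow> nat \<Rightarrow> ('a \<times> 'a) set" where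
  "pairs_at_dist G h = {(u, v) \<in> verts G \<times> verts G. vdist G u v = ereal (real h)}"

definition punctually_walk_regular :: "nat \<Rightarrow> ('a, 'b) pre_digraph \<Rightarrow> bool" where
  "punctually_walk_regular h G \<longleftrightarrow>
     (\<forall>k. \<forall>(u, v)\<in>pairs_at_dist G h. \<forall>(w, z)\<in>pairs_at_dist G h.
        entry G (adj_mat G ^\<^sub>m k) u v = entry G (adj_mat G ^\<^sub>m k) w z)"

definition punctually_spectrum_regular :: "nat \<Rightarrow> ('a, 'b) pre_digraph \<Rightarrow> bool" where
  "punctually_spectrum_regular h G \<longleftrightarrow>
     (\<forall>l\<in>spectrum (adj_mat G). \<forall>(u, v)\<in>pairs_at_dist G h. \<forall>(w, z)\<in>pairs_at_dist G h.
        entry G (eigenproj G l) u v = entry G (eigenproj G l) w z)"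

text \<open>For \<open>u = v\<close> the second deletion has no effect.\<close>

definition del_two :: "('a, 'b) pre_digraph \<Rightarrow> 'a \<Rightarrow> 'a \<Rightarrow> ('a, 'b) pre_digraph" where
  "del_two G u v = pre_digraph.del_vert (pre_digraph.del_vert G u) v"

definition punctually_cospectral :: "nat \<Rightarrow> ('a, 'b) pre_digraph \<Rightarrow> bool" where
  "punctually_cospectral h G \<longleftrightarrow>
     (\<forall>(u, v)\<in>pairs_at_dist G h. \<forall>(w, z)\<in>pairs_at_dist G h.
        sp (del_two G u v) = sp (del_two G w z))"

end

theory Submission
  imports Defs "HOL-Computational_Algebra.Polynomial_FPS"
begin

text \<open>
  The powers of \<open>A\<close> are linear combinations of the projections \<open>E\<^sub>i\<close>, with coefficients the powers
  of the eigenvalues, and conversely each \<open>E\<^sub>i\<close> is a polynomial in \<open>A\<close>; so equal walk counts and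
  equal projection entries are the same condition on two pairs of vertices.

  For cospectrality, let \<open>W\<^sub>u\<^sub>v\<close> be the generating function of the walks from \<open>u\<close> to \<open>v\<close>. These
  series are the entries of the inverse of \<open>1 - X A\<close>, and Jacobi's identity for complementary
  minors gives \<open>det (1 - X A') = det (1 - X A) (W\<^sub>u\<^sub>u W\<^sub>v\<^sub>v - W\<^sub>u\<^sub>v\<^sup>2)\<close> for the adjacency matrix \<open>A'\<close> of
  \<open>G - u - v\<close>. In a walk-regular graph the spectrum of \<open>G - u - v\<close> therefore determines, and is
  determined by, \<open>W\<^sub>u\<^sub>v\<^sup>2\<close>. Power series over the reals form an integral domain, so \<open>W\<^sub>u\<^sub>v\<close> is known up
  to sign, and the sign is fixed because the coefficient of \<open>X\<^sup>h\<close> is positive.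
\<close>

subsection \<open>Real symmetric matrices\<close>

text \<open>Over the complex numbers an eigenvalue exists because \<open>n > 0\<close>. The
  Hermitian form of \<open>A\<close> at an eigenvector \<open>x\<close> is invariant under
  conjugation and equals the eigenvalue times the squared norm of \<open>x\<close>, so the
  eigenvalue is real.\<close>

lemma symmetric_real_eigenvalue:
  fixes A :: "real mat"
  assumes A: "A \<in> carrier_mat n n" and sym: "transpose_mat A = A" and n: "n > 0"
  shows "\<exists>e. eigenvalue A e"
proof -
  let ?A = "map_mat of_real A :: complex mat"
  have cA: "?A \<in> carrier_mat n n" using A by auto
  have symA: "A $$ (i,j) = A $$ (j,i)" if "i < n" "j < n" for i j
    using arg_cong[OF sym, of "\<lambda>M. M $$ (i,j)"] that A by simp
  obtain \<mu> where \<mu>: "eigenvalue ?A \<mu>"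
    using spectrum_non_empty[OF cA n] by (auto simp: spectrum_def)
  then obtain x where x: "x \<in> carrier_vec n" "x \<noteq> 0\<^sub>v n" "?A *\<^sub>v x = \<mu> \<cdot>\<^sub>v x"
    using cA unfolding eigenvalue_def eigenvector_def by auto
  have Ax: "(\<Sum>j<n. of_real (A $$ (i,j)) * x $ j) = \<mu> * x $ i" if "i < n" for i
  proof -
    have "(\<Sum>j<n. of_real (A $$ (i,j)) * x $ j) = (?A *\<^sub>v x) $ i"
      using that A x(1) by (auto simp: scalar_prod_def atLeast0LessThan)
    then show ?thesis using x that by simp
  qed
  define S where "S = (\<Sum>i<n. \<Sum>j<n. of_real (A $$ (i,j)) * (cnj (x $ i) * x $ j))"
  have S1: "S = \<mu> * (\<Sum>i<n. cnj (x $ i) * x $ i)"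
    unfolding S_def sum_distrib_left
  proof (rule sum.cong[OF refl])
    fix i assume "i \<in> {..<n}"
    then have "(\<Sum>j<n. of_real (A $$ (i,j)) * (cnj (x $ i) * x $ j))
      = cnj (x $ i) * (\<mu> * x $ i)"
      by (simp add: Ax[symmetric] sum_distrib_left mult_ac)
    then show "(\<Sum>j<n. of_real (A $$ (i,j)) * (cnj (x $ i) * x $ j)) = \<mu> * (cnj (x $ i) * x $ i)"
      by (simp add: mult_ac)
  qed
  have "cnj S = (\<Sum>i<n. \<Sum>j<n. of_real (A $$ (i,j)) * (x $ i * cnj (x $ j)))"
    unfolding S_def by simp
  also have "\<dots> = (\<Sum>j<n. \<Sum>i<n. of_real (A $$ (i,j)) * (x $ i * cnj (x $ j)))"
    by (rule sum.swap)
  also have "\<dots> = S" unfolding S_def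
    by (intro sum.cong refl) (auto simp: symA mult_ac)
  finally have cS: "cnj S = S" .
  define N where "N = (\<Sum>i<n. (cmod (x $ i))\<^sup>2)"
  have N: "(\<Sum>i<n. cnj (x $ i) * x $ i) = of_real N"
    unfolding N_def of_real_sum by (intro sum.cong refl) (metis complex_norm_square mult.commute)
  have "N \<noteq> 0"
  proof
    assume "N = 0"
    then have "\<forall>i<n. x $ i = 0"
      unfolding N_def by (subst (asm) sum_nonneg_eq_0_iff) auto
    then have "x = 0\<^sub>v n" using x(1) by (intro eq_vecI) auto
    with x(2) show False by simp
  qed
  then have "cnj \<mu> = \<mu>" using cS unfolding S1 N by simp
  then have \<mu>r: "\<mu> = of_real (Re \<mu>)" by (metis Reals_cnj_iff of_real_Re)
  \<comment> \<open>The characteristic polynomial of the complexified matrix is the image of the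
    real one, so a real root descends.\<close>
  have "poly (map_poly of_real (char_poly A)) (of_real (Re \<mu>) :: complex) = 0"
    using \<mu> unfolding eigenvalue_root_char_poly[OF cA] of_real_hom.char_poly_hom[OF A]
    by (simp flip: \<mu>r)
  then have "poly (char_poly A) (Re \<mu>) = 0" by simp
  then show ?thesis using eigenvalue_root_char_poly[OF A] by blast
qed

text \<open>Extends a unit vector to an orthogonal matrix. With \<open>w\<close> the difference of
  \<open>v\<close> and the first unit vector, the reflection along \<open>w\<close> is
  \<open>1 - 2 w w^T / (w^T w)\<close>; it is symmetric and its own inverse, which makes conjugation
  by it easy to undo.\<close>

lemma householder_reflection:
  fixes v :: "real vec"
  assumes v: "v \<in> carrier_vec n" and n: "n > 0" and norm: "v \<bullet> v = 1"
  shows "\<exists>Q\<in>carrier_mat n n. transpose_mat Q = Q \<and> Q * Q = 1\<^sub>m n \<and> col Q 0 = v"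
proof -
  \<comment> \<open>The reflection exchanges \<open>v\<close> and the first unit vector. If they coincide, then \<open>s = 0\<close>,
    so \<open>c = 2 / 0 = 0\<close> and \<open>Q\<close> is the identity.\<close>
  define w where "w = (\<lambda>i. v $ i - (if i = 0 then 1 else 0))"
  define s where "s = (\<Sum>i<n. w i * w i)"
  define c where "c = 2 / s"
  define Q where "Q = mat n n (\<lambda>(i,j). (if i = j then 1 else 0) - c * w i * w j)"
  have Q: "Q \<in> carrier_mat n n" unfolding Q_def by auto
  have vv: "(\<Sum>i<n. v $ i * v $ i) = 1"
    using norm v by (simp add: scalar_prod_def atLeast0LessThan)
  \<comment> \<open>As \<open>v\<close> has norm 1, the square norm of \<open>w\<close> is
    \<open>2 - 2 * v $ 0\<close>, which is \<open>- 2 * w 0\<close>.\<close>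
  have "s = (\<Sum>i<n. v $ i * v $ i) - 2 * (\<Sum>i<n. (if i = 0 then v $ i else 0)) + (\<Sum>i<n. (if i = 0 then 1 else 0))"
    unfolding s_def w_def sum_distrib_left sum.distrib[symmetric] sum_subtractf[symmetric]
    by (intro sum.cong refl) (auto simp: algebra_simps)
  also have "\<dots> = - 2 * w 0" using n by (simp add: vv w_def)
  finally have s: "s = - 2 * w 0" .
  have w0: "w i = 0" if "s = 0" "i < n" for i
    using that unfolding s_def by (subst (asm) sum_nonneg_eq_0_iff) auto
  \<comment> \<open>For \<open>s = 0\<close> the factor \<open>c * s\<close> is 0 instead of 2, but
    then \<open>w\<close> vanishes as well.\<close>
  have cs: "c * s * w i = 2 * w i" if "i < n" for i
    using w0[OF _ that] unfolding c_def by (cases "s = 0") auto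
  have "(Q * Q) $$ (i,j) = 1\<^sub>m n $$ (i,j)" if ij: "i < n" "j < n" for i j
  proof -
    have "(Q * Q) $$ (i,j) = (\<Sum>k<n. ((if i = k then 1 else 0) - c * w i * w k) * ((if k = j then 1 else 0) - c * w k * w j))"
      using ij by (simp add: Q_def scalar_prod_def atLeast0LessThan)
    also have "\<dots> = (\<Sum>k<n. (if k = i then (if i = j then 1 else 0) - c * w i * w j else 0)
        - (if k = j then c * w i * w j else 0) + c * w i * (c * w j) * (w k * w k))"
      by (intro sum.cong refl) (auto simp: algebra_simps)
    also have "\<dots> = (if i = j then 1 else 0) - 2 * (c * w i * w j) + c * w i * (c * w j * s)"
      using ij by (simp add: sum.distrib sum_subtractf sum_distrib_left[symmetric] s_def)
    also have "c * w j * s = 2 * w j" using cs[OF ij(2)] by (simp add: mult_ac)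
    finally show ?thesis using ij by (simp add: algebra_simps)
  qed
  then have "Q * Q = 1\<^sub>m n" using Q by (intro eq_matI) auto
  moreover have "transpose_mat Q = Q" using Q by (intro eq_matI) (auto simp: Q_def)
  moreover have "col Q 0 = v"
  proof (rule eq_vecI)
    fix i assume "i < dim_vec v"
    then have i: "i < n" using v by auto
    have "w i + c * w i * w 0 = 0"
    proof (cases "s = 0")
      case True then show ?thesis using w0[OF _ i] by simp
    next
      case False then show ?thesis unfolding c_def using s by (simp add: field_simps)
    qed
    then show "col Q 0 $ i = v $ i" using i n by (auto simp: Q_def w_def algebra_simps)
  qed (use Q v in auto)
  ultimately show ?thesis using Q by blast
qed

text \<open>Induction on the dimension. Conjugation by a Householder reflection whose first column
  is a unit eigenvector splits off a block of size 1, and the induction hypothesis diagonalizes the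
  remaining symmetric block.\<close>

lemma symmetric_orthogonally_diagonalizable:
  fixes A :: "real mat"
  assumes "A \<in> carrier_mat n n" and "transpose_mat A = A"
  shows "\<exists>P d. P \<in> carrier_mat n n \<and> transpose_mat P * P = 1\<^sub>m n \<and> P * transpose_mat P = 1\<^sub>m n \<and>
    A = P * mat_diag n d * transpose_mat P"
  using assms
proof (induction n arbitrary: A)
  case 0
  then show ?case by (intro exI[of _ "1\<^sub>m 0"] exI[of _ "\<lambda>_. 0"]) (auto intro!: eq_matI)
next
  case (Suc m A)
  let ?n = "Suc m"
  note A = Suc.prems(1) and sym = Suc.prems(2)
  obtain e x where x: "x \<in> carrier_vec ?n" "x \<noteq> 0\<^sub>v ?n" "A *\<^sub>v x = e \<cdot>\<^sub>v x"
    using symmetric_real_eigenvalue[OF A sym] A unfolding eigenvalue_def eigenvector_def by auto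
  have xx: "x \<bullet> x > 0" using x(1,2) conjugate_square_greater_0_vec[of x ?n] by simp
  define v where "v = (1 / sqrt (x \<bullet> x)) \<cdot>\<^sub>v x"
  have v: "v \<in> carrier_vec ?n" using x v_def by simp
  have "v \<bullet> v = 1" using x(1) xx unfolding v_def by simp
  have Av: "A *\<^sub>v v = e \<cdot>\<^sub>v v"
    unfolding v_def using A x by (simp add: mult_mat_vec smult_smult_assoc mult.commute)
  obtain Q where Q: "Q \<in> carrier_mat ?n ?n" and Qt: "transpose_mat Q = Q" and QQ: "Q * Q = 1\<^sub>m ?n"
    and Q0: "col Q 0 = v"
    using householder_reflection[OF v _ \<open>v \<bullet> v = 1\<close>] by auto
  define B where "B = Q * A * Q"
  have B: "B \<in> carrier_mat ?n ?n" using Q A B_def by auto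
  have Bt: "transpose_mat B = B"
    unfolding B_def using Q A by (simp add: transpose_mult[of _ ?n ?n _ ?n] Qt sym assoc_mult_mat[of _ ?n ?n _ ?n _ ?n])
  have Beq: "A = Q * B * Q"
  proof -
    have "Q * B * Q = (Q * Q) * A * (Q * Q)"
      unfolding B_def using Q A by (simp add: assoc_mult_mat[of _ ?n ?n _ ?n _ ?n])
    then show ?thesis using QQ A by simp
  qed
  \<comment> \<open>Since \<open>Q\<close> exchanges \<open>v\<close> and the first unit vector,
    \<open>B\<close> maps that unit vector to \<open>e\<close> times itself. Symmetry then clears
    the first row too.\<close>
  have Bcol: "col B 0 = e \<cdot>\<^sub>v unit_vec ?n 0"
  proof -
    have "col B 0 = (Q * A) *\<^sub>v col Q 0" unfolding B_def using Q A by (intro col_mult2[of _ ?n ?n _ ?n]) auto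
    also have "\<dots> = Q *\<^sub>v (A *\<^sub>v v)" using Q A v Q0 by (simp add: assoc_mult_mat_vec)
    also have "\<dots> = e \<cdot>\<^sub>v (Q *\<^sub>v col Q 0)" unfolding Av Q0 using Q v by (simp add: mult_mat_vec)
    also have "Q *\<^sub>v col Q 0 = col (Q * Q) 0" using Q by (intro col_mult2[symmetric, of _ ?n ?n _ ?n]) auto
    finally show ?thesis unfolding QQ by simp
  qed
  have B0: "B $$ (i, 0) = (if i = 0 then e else 0)" if "i < ?n" for i
    using arg_cong[OF Bcol, of "\<lambda>u. u $ i"] that B by auto
  have B0': "B $$ (0, i) = (if i = 0 then e else 0)" if "i < ?n" for i
    using arg_cong[OF Bt, of "\<lambda>M. M $$ (i,0)"] that B B0[OF that] by simp
  define C where "C = mat m m (\<lambda>(i,j). B $$ (Suc i, Suc j))"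
  have C: "C \<in> carrier_mat m m" unfolding C_def by auto
  have "transpose_mat C = C"
  proof (rule eq_matI)
    fix i j assume ij: "i < dim_row C" "j < dim_col C"
    then have "B $$ (Suc j, Suc i) = B $$ (Suc i, Suc j)"
      using arg_cong[OF Bt, of "\<lambda>M. M $$ (Suc i,Suc j)"] B C by simp
    then show "transpose_mat C $$ (i, j) = C $$ (i, j)" using ij by (simp add: C_def)
  qed (use C in auto)
  from Suc.IH[OF C this] obtain P d where P: "P \<in> carrier_mat m m"
    and PP: "transpose_mat P * P = 1\<^sub>m m" "P * transpose_mat P = 1\<^sub>m m"
    and CP: "C = P * mat_diag m d * transpose_mat P" by blast
  define R where "R = four_block_mat (1\<^sub>m 1) (0\<^sub>m 1 m) (0\<^sub>m m 1) P"
  define d' where "d' = (\<lambda>i. case i of 0 \<Rightarrow> e | Suc i \<Rightarrow> d i)"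
  have R: "R \<in> carrier_mat ?n ?n" unfolding R_def using P by (metis four_block_carrier_mat one_carrier_mat plus_1_eq_Suc)
  have Rt: "transpose_mat R = four_block_mat (1\<^sub>m 1) (0\<^sub>m 1 m) (0\<^sub>m m 1) (transpose_mat P)"
    unfolding R_def using P by (subst transpose_four_block_mat[of _ 1 1 _ m _ m]) auto
  have one: "four_block_mat (1\<^sub>m 1) (0\<^sub>m 1 m) (0\<^sub>m m 1) (1\<^sub>m m) = 1\<^sub>m ?n"
    by (metis four_block_one_mat plus_1_eq_Suc)
  have mult: "four_block_mat X (0\<^sub>m 1 m) (0\<^sub>m m 1) Y * four_block_mat X' (0\<^sub>m 1 m) (0\<^sub>m m 1) Y'
     = four_block_mat (X * X') (0\<^sub>m 1 m) (0\<^sub>m m 1) (Y * Y')"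
    if "X \<in> carrier_mat 1 1" "X' \<in> carrier_mat 1 1" "Y \<in> carrier_mat m m" "Y' \<in> carrier_mat m m" for X X' Y Y' :: "real mat"
    using that by (subst mult_four_block_mat[of _ 1 1 _ m _ m]) auto
  have RR: "transpose_mat R * R = 1\<^sub>m ?n" "R * transpose_mat R = 1\<^sub>m ?n"
    unfolding Rt unfolding R_def using P by (simp_all add: mult PP plus_1_eq_Suc del: One_nat_def)
  have D: "mat_diag ?n d' = four_block_mat (mat_diag 1 (\<lambda>_. e)) (0\<^sub>m 1 m) (0\<^sub>m m 1) (mat_diag m d)"
    by (rule eq_matI) (auto simp: mat_diag_def d'_def split: nat.splits)
  have "B = four_block_mat (mat_diag 1 (\<lambda>_. e)) (0\<^sub>m 1 m) (0\<^sub>m m 1) C"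
    using B by (intro eq_matI) (auto simp: mat_diag_def C_def B0 B0' less_Suc_eq_0_disj)
  also have "\<dots> = R * mat_diag ?n d' * transpose_mat R"
  proof -
    have "P * mat_diag m d \<in> carrier_mat m m" using P by auto
    moreover have "1\<^sub>m 1 * mat_diag 1 (\<lambda>_. e) = mat_diag 1 (\<lambda>_. e)"
      "mat_diag 1 (\<lambda>_. e) * 1\<^sub>m 1 = mat_diag 1 (\<lambda>_. e)"
      by (rule left_mult_one_mat[OF mat_diag_dim] right_mult_one_mat[OF mat_diag_dim])+
    ultimately show ?thesis
      unfolding Rt D unfolding R_def using P by (simp add: mult CP del: One_nat_def)
  qed
  finally have BR: "B = R * mat_diag ?n d' * transpose_mat R" .
  define P' where "P' = Q * R"
  have P': "P' \<in> carrier_mat ?n ?n" using Q R P'_def by auto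
  have P't: "transpose_mat (Q * R) = transpose_mat R * Q"
    using Q R by (simp add: transpose_mult[of _ ?n ?n _ ?n] Qt)
  have Dc: "mat_diag ?n d' \<in> carrier_mat ?n ?n" by (simp add: mat_diag_def)
  have "transpose_mat P' * P' = transpose_mat R * (Q * Q) * R"
    unfolding P'_def P't using Q R by (simp add: assoc_mult_mat[of _ ?n ?n _ ?n _ ?n])
  moreover have "P' * transpose_mat P' = Q * (R * transpose_mat R) * Q"
    unfolding P'_def P't using Q R by (simp add: assoc_mult_mat[of _ ?n ?n _ ?n _ ?n])
  moreover have "P' * mat_diag ?n d' * transpose_mat P' = Q * (R * mat_diag ?n d' * transpose_mat R) * Q"
    unfolding P'_def P't using Q R Dc by (simp add: mult_carrier_mat[of _ ?n ?n _ ?n] assoc_mult_mat[of _ ?n ?n _ ?n _ ?n])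
  ultimately show ?case using P' QQ RR Q R Beq BR by (intro exI[of _ P'] exI[of _ d']) simp
qed

section \<open>Diagonal matrices and orthogonal projections\<close>

lemma mat_diag_pow: "mat_diag n d ^\<^sub>m k = mat_diag n (\<lambda>i. d i ^ k :: 'a :: comm_semiring_1)"
  proof (induction k)
  case 0
  then show ?case by (auto simp: mat_diag_def)
qed (simp add: mult.commute)

lemma diag_conj_index:
  fixes P :: "'a :: comm_ring_1 mat"
  assumes P: "P \<in> carrier_mat n n" and ij: "i < n" "j < n"
  shows "(P * mat_diag n f * transpose_mat P) $$ (i,j) = (\<Sum>l<n. f l * (P $$ (i,l) * P $$ (j,l)))"
  using ij P by (auto simp: mat_diag_mult_right[OF P] scalar_prod_def atLeast0LessThan mult_ac intro!: sum.cong)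

lemma smult_mult_mat_vec:
  fixes A :: "'a :: comm_ring_1 mat"
  shows "A \<in> carrier_mat nr nc \<Longrightarrow> v \<in> carrier_vec nc \<Longrightarrow> (k \<cdot>\<^sub>m A) *\<^sub>v v = k \<cdot>\<^sub>v (A *\<^sub>v v)"
  by (intro eq_vecI) (auto simp: scalar_prod_def sum_distrib_left mult.assoc)

lemma index_mat_diag_mult_vec:
  fixes v :: "'a :: comm_ring_1 vec"
  shows "v \<in> carrier_vec n \<Longrightarrow> i < n \<Longrightarrow> (mat_diag n f *\<^sub>v v) $ i = f i * v $ i"
  by (simp add: mat_diag_def scalar_prod_def if_distrib[of "\<lambda>x. x * _"] cong: if_cong)

text \<open>Discharges the uniqueness part of the definite description: for two candidates
  \<open>E\<close> and \<open>F\<close>, the vector \<open>F *\<^sub>v x - E *\<^sub>v x\<close>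
  lies in \<open>W\<close> and is orthogonal to \<open>W\<close>, hence to itself, so it is
  zero.\<close>

lemma orth_proj_eqI:
  assumes E: "E \<in> carrier_mat n n" and W: "W \<subseteq> carrier_vec n"
    and sub: "\<And>x y. x \<in> W \<Longrightarrow> y \<in> W \<Longrightarrow> x - y \<in> W"
    and proj: "\<And>x. x \<in> carrier_vec n \<Longrightarrow> E *\<^sub>v x \<in> W"
    and orth: "\<And>x y. x \<in> carrier_vec n \<Longrightarrow> y \<in> W \<Longrightarrow> (x - E *\<^sub>v x) \<bullet> y = 0"
  shows "orth_proj n W = E"
  unfolding orth_proj_def
proof (rule the_equality)
  show "E \<in> carrier_mat n n \<and>
     (\<forall>x\<in>carrier_vec n. E *\<^sub>v x \<in> W \<and> (\<forall>y\<in>W. (x - E *\<^sub>v x) \<bullet> y = 0))"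
    using E proj orth by blast
next
  fix F assume F: "F \<in> carrier_mat n n \<and>
     (\<forall>x\<in>carrier_vec n. F *\<^sub>v x \<in> W \<and> (\<forall>y\<in>W. (x - F *\<^sub>v x) \<bullet> y = 0))"
  have eq: "F *\<^sub>v x = E *\<^sub>v x" if x: "x \<in> carrier_vec n" for x
  proof -
    define y where "y = F *\<^sub>v x - E *\<^sub>v x"
    have y: "y \<in> W" unfolding y_def using sub F proj x by blast
    have yc: "y \<in> carrier_vec n" and Fx: "F *\<^sub>v x \<in> carrier_vec n" and Ex: "E *\<^sub>v x \<in> carrier_vec n"
      using y W F E x by auto
    \<comment> \<open>This writes \<open>y\<close> as a difference of the two residuals, each of
      which is orthogonal to \<open>W\<close>.\<close>
    have "a - b = (c - b) - (c - a)"
      if "a \<in> carrier_vec n" "b \<in> carrier_vec n" "c \<in> carrier_vec n" for a b c :: "real vec"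
      using that by (intro eq_vecI) auto
    from this[OF Fx Ex x] have "y = (x - E *\<^sub>v x) - (x - F *\<^sub>v x)"
      unfolding y_def .
    then have "y \<bullet> y = (x - E *\<^sub>v x) \<bullet> y - (x - F *\<^sub>v x) \<bullet> y"
      using minus_scalar_prod_distrib[of "x - E *\<^sub>v x" n "x - F *\<^sub>v x" y] x Fx Ex yc by auto
    also have "\<dots> = 0" using orth[OF x y] F x y by simp
    finally have "y = 0\<^sub>v n" using conjugate_square_eq_0_vec[OF yc] by simp
    then show ?thesis unfolding y_def using Fx Ex
      by (metis (no_types, lifting) eq_vecI index_minus_vec(1) index_zero_vec(1) carrier_vecD right_minus_eq)
  qed
  show "F = E"
  proof (rule eq_matI)
    fix i j assume ij: "i < dim_row E" "j < dim_col E"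
    then show "F $$ (i,j) = E $$ (i,j)"
      using arg_cong[OF eq[OF unit_vec_carrier, of j], of "\<lambda>v. v $ i"] E F by auto
  qed (use E F in auto)
qed

section \<open>Powers, spectrum and eigenprojections of an orthogonally diagonalized matrix\<close>

locale spectral_decomposition =
  fixes A :: "real mat" and n :: nat and P :: "real mat" and d :: "nat \<Rightarrow> real"
  assumes P: "P \<in> carrier_mat n n"
    and PtP: "transpose_mat P * P = 1\<^sub>m n" and PPt: "P * transpose_mat P = 1\<^sub>m n"
    and A_eq: "A = P * mat_diag n d * transpose_mat P"
begin

lemma carrier: "A \<in> carrier_mat n n"
  using P A_eq by auto

lemma similar: "similar_mat_wit A (mat_diag n d) P (transpose_mat P)"
  unfolding similar_mat_wit_def using P carrier PtP PPt A_eq by (auto simp: Let_def)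

lemma pow_eq: "A ^\<^sub>m k = P * mat_diag n (\<lambda>i. d i ^ k) * transpose_mat P"
  using similar_mat_wit_pow[OF similar, of k] unfolding similar_mat_wit_def Let_def mat_diag_pow by auto

lemma pow_index:
  "i < n \<Longrightarrow> j < n \<Longrightarrow> (A ^\<^sub>m k) $$ (i,j) = (\<Sum>l<n. d l ^ k * (P $$ (i,l) * P $$ (j,l)))"
  unfolding pow_eq by (rule diag_conj_index[OF P])

lemma char_poly_eq: "char_poly A = (\<Prod>i\<leftarrow>[0..<n]. [:- d i, 1:])"
proof -
  have "char_poly A = char_poly (mat_diag n d)"
    using similar by (intro char_poly_similar) (auto simp: similar_mat_def)
  also have "\<dots> = (\<Prod>a\<leftarrow>diag_mat (mat_diag n d). [:- a, 1:])"
    by (rule char_poly_upper_triangular[of _ n]) (auto simp: mat_diag_def)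
  also have "diag_mat (mat_diag n d) = map d [0..<n]"
    by (auto simp: diag_mat_def mat_diag_def)
  finally show ?thesis by (simp add: o_def)
qed

lemma spectrum_eq: "spectrum A = d ` {..<n}"
  unfolding spectrum_root_char_poly[OF carrier] char_poly_eq
  by (auto simp: poly_prod_list prod_list_zero_iff)

text \<open>The characteristic polynomial splits into linear factors over the reals, so the multiset
  of its real roots determines it.\<close>

lemma char_poly_proots: "char_poly A = (\<Prod>a\<in>#proots (char_poly A). [:- a, 1:])"
proof -
  have "proots (\<Prod>i\<leftarrow>xs. [:- d i, 1:]) = mset (map d xs)" for xs
  proof (induction xs)
    case (Cons a xs)
    have "(\<Prod>i\<leftarrow>xs. [:- d i, 1:]) \<noteq> 0" by (auto simp: prod_list_zero_iff)
    then have "proots ([:- d a, 1:] * (\<Prod>i\<leftarrow>xs. [:- d i, 1:]))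
        = proots [:- d a, 1:] + proots (\<Prod>i\<leftarrow>xs. [:- d i, 1:])"
      by (intro proots_mult) auto
    then show ?case using Cons.IH by simp
  qed simp
  then have "proots (char_poly A) = mset (map d [0..<n])" unfolding char_poly_eq .
  then show ?thesis
    by (simp only: char_poly_eq mset_map image_mset.compositionality o_def prod_mset_prod_list[symmetric])
qed

text \<open>The right-hand side \<open>E\<close> satisfies
  \<open>A * E = l \<cdot>\<^sub>m E\<close>, so its range lies in the eigenspace. It fixes the
  eigenspace and is symmetric, so for \<open>y\<close> in the eigenspace the scalar product of
  \<open>x - E *\<^sub>v x\<close> and \<open>y\<close> is that of \<open>x\<close> with
  \<open>y - E *\<^sub>v y = 0\<close>.\<close>

lemma orth_proj_kernel:
  "orth_proj n (mat_kernel (l \<cdot>\<^sub>m 1\<^sub>m n - A))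
    = P * mat_diag n (\<lambda>i. if d i = l then 1 else 0) * transpose_mat P"
proof -
  let ?D = "mat_diag n (\<lambda>i. if d i = l then 1 else 0) :: real mat"
  define E where "E = P * ?D * transpose_mat P"
  have E: "E \<in> carrier_mat n n" using P E_def by auto
  have "E $$ (i,j) = E $$ (j,i)" if "i < n" "j < n" for i j
    unfolding E_def using that by (simp only: diag_conj_index[OF P] mult.commute)
  then have Et: "transpose_mat E = E" using E by (intro eq_matI) auto
  define W where "W = {v \<in> carrier_vec n. A *\<^sub>v v = l \<cdot>\<^sub>v v}"
  have W: "mat_kernel (l \<cdot>\<^sub>m 1\<^sub>m n - A) = W"
  proof -
    have "(l \<cdot>\<^sub>m 1\<^sub>m n - A) *\<^sub>v v = l \<cdot>\<^sub>v v - A *\<^sub>v v" if "v \<in> carrier_vec n" for v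
      using that carrier by (simp add: minus_mult_distrib_mat_vec[of _ n n] smult_mult_mat_vec[of _ n n])
    moreover have "l \<cdot>\<^sub>v v - A *\<^sub>v v = 0\<^sub>v n \<longleftrightarrow> A *\<^sub>v v = l \<cdot>\<^sub>v v" if "v \<in> carrier_vec n" for v
      using that carrier by (auto simp: vec_eq_iff)
    ultimately show ?thesis
      using carrier unfolding W_def mat_kernel_def by auto
  qed
  have fix_W: "E *\<^sub>v y = y" if y: "y \<in> W" for y
  proof -
    have yc: "y \<in> carrier_vec n" and Ay: "A *\<^sub>v y = l \<cdot>\<^sub>v y" using y W_def by auto
    \<comment> \<open>The coordinates of \<open>y\<close> in the eigenbasis: they vanish at every
      \<open>i\<close> with \<open>d i \<noteq> l\<close>, so the 0-1 diagonal matrix leaves them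
      unchanged.\<close>
    define z where "z = transpose_mat P *\<^sub>v y"
    have z: "z \<in> carrier_vec n" using P z_def yc by auto
    have Pz: "P *\<^sub>v z = y"
      unfolding z_def using P yc PPt by (simp flip: assoc_mult_mat_vec)
    have "mat_diag n d *\<^sub>v z = l \<cdot>\<^sub>v z"
    proof -
      have "transpose_mat P *\<^sub>v (A *\<^sub>v y) = (transpose_mat P * A) *\<^sub>v y"
        using P yc carrier by (simp add: assoc_mult_mat_vec[of _ n n _ n])
      also have "transpose_mat P * A = (transpose_mat P * P) * mat_diag n d * transpose_mat P"
        unfolding A_eq using P by (simp add: mult_carrier_mat[of _ n n _ n] assoc_mult_mat[of _ n n _ n _ n])
      also have "\<dots> = mat_diag n d * transpose_mat P"
        unfolding PtP by (simp add: left_mult_one_mat[OF mat_diag_dim])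
      also have "\<dots> *\<^sub>v y = mat_diag n d *\<^sub>v z"
        unfolding z_def using P yc by (simp add: assoc_mult_mat_vec[of _ n n _ n])
      finally show ?thesis unfolding Ay z_def using P yc by (simp add: mult_mat_vec[of _ n n])
    qed
    then have dz: "d i * z $ i = l * z $ i" if "i < n" for i
      using that z by (metis index_mat_diag_mult_vec index_smult_vec(1) carrier_vecD)
    have Dz: "?D *\<^sub>v z = z"
    proof (rule eq_vecI)
      fix i assume "i < dim_vec z"
      then have "i < n" using z by auto
      then show "(?D *\<^sub>v z) $ i = z $ i" using z dz[OF \<open>i < n\<close>]
        by (auto simp: index_mat_diag_mult_vec)
    qed (use z in \<open>auto simp: mat_diag_def\<close>)
    have "E *\<^sub>v y = P *\<^sub>v (?D *\<^sub>v z)"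
      unfolding E_def z_def using P yc by (simp add: assoc_mult_mat_vec[of _ n n _ n])
    then show ?thesis unfolding Dz Pz .
  qed
  have AE: "A * E = l \<cdot>\<^sub>m E"
  proof -
    have "A * E = P * mat_diag n d * (transpose_mat P * P) * ?D * transpose_mat P"
      unfolding A_eq E_def using P by (simp add: mult_carrier_mat[of _ n n _ n] assoc_mult_mat[of _ n n _ n _ n])
    also have "\<dots> = P * (mat_diag n d * ?D) * transpose_mat P"
      unfolding PtP using P by (simp add: left_mult_one_mat[of _ n n] mult_carrier_mat[of _ n n _ n] assoc_mult_mat[of _ n n _ n _ n] del: mat_diag_diag)
    also have "mat_diag n d * ?D = l \<cdot>\<^sub>m ?D"
      unfolding mat_diag_diag by (rule eq_matI) (auto simp: mat_diag_def)
    also have "P * (l \<cdot>\<^sub>m ?D) * transpose_mat P = l \<cdot>\<^sub>m E"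
      unfolding E_def using P by (simp add: mult_smult_distrib[of _ n n _ n] mult_smult_assoc_mat[of _ n n _ n])
    finally show ?thesis .
  qed
  have "orth_proj n W = E"
  proof (rule orth_proj_eqI[OF E])
    show "W \<subseteq> carrier_vec n" using W_def by auto
    show "x - y \<in> W" if "x \<in> W" "y \<in> W" for x y
    proof -
      have "A *\<^sub>v (x - y) = l \<cdot>\<^sub>v x - l \<cdot>\<^sub>v y"
        using that carrier unfolding W_def by (simp add: mult_minus_distrib_mat_vec[of _ n n])
      also have "\<dots> = l \<cdot>\<^sub>v (x - y)"
        using that unfolding W_def by (intro eq_vecI) (auto simp: algebra_simps)
      finally show ?thesis using that unfolding W_def by auto
    qed
    fix x :: "real vec" assume x: "x \<in> carrier_vec n"
    have "A *\<^sub>v (E *\<^sub>v x) = (A * E) *\<^sub>v x" using carrier E x by simp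
    also have "\<dots> = l \<cdot>\<^sub>v (E *\<^sub>v x)" unfolding AE using E x by (simp add: smult_mult_mat_vec[of _ n n])
    finally show Ex: "E *\<^sub>v x \<in> W" unfolding W_def using E x by auto
    show "(x - E *\<^sub>v x) \<bullet> y = 0" if y: "y \<in> W" for y
    proof -
      have yc: "y \<in> carrier_vec n" using y W_def by auto
      have "(E *\<^sub>v x) \<bullet> y = x \<bullet> (transpose_mat E *\<^sub>v y)"
        by (metis E Et x yc transpose_vec_mult_scalar transpose_carrier_mat comm_scalar_prod mult_mat_vec_carrier)
      then show ?thesis
        using fix_W[OF y] Et E x yc by (simp add: minus_scalar_prod_distrib[of _ n])
    qed
  qed
  then show ?thesis unfolding W E_def .
qed

lemma orth_proj_kernel_index:
  assumes "i < n" "j < n"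
  shows "orth_proj n (mat_kernel (l \<cdot>\<^sub>m 1\<^sub>m n - A)) $$ (i,j)
    = (\<Sum>m<n. if d m = l then P $$ (i,m) * P $$ (j,m) else 0)"
  unfolding orth_proj_kernel diag_conj_index[OF P assms]
  by (intro sum.cong refl) simp

text \<open>The spectral formula for \<open>A ^\<^sub>m k\<close>, read entrywise. It arises from
  the sum over the columns of \<open>P\<close> by grouping the columns with the same
  eigenvalue.\<close>

lemma pow_index_eq_sum_orth_proj:
  assumes "i < n" "j < n"
  shows "(A ^\<^sub>m k) $$ (i,j)
    = (\<Sum>l\<in>spectrum A. l ^ k * orth_proj n (mat_kernel (l \<cdot>\<^sub>m 1\<^sub>m n - A)) $$ (i,j))"
proof -
  have "(\<Sum>l\<in>spectrum A. l ^ k * orth_proj n (mat_kernel (l \<cdot>\<^sub>m 1\<^sub>m n - A)) $$ (i,j))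
    = (\<Sum>m<n. \<Sum>l\<in>spectrum A. if l = d m then l ^ k * (P $$ (i,m) * P $$ (j,m)) else 0)"
    unfolding orth_proj_kernel_index[OF assms] sum_distrib_left
    by (subst sum.swap) (auto intro!: sum.cong)
  also have "\<dots> = (\<Sum>m<n. d m ^ k * (P $$ (i,m) * P $$ (j,m)))"
    by (intro sum.cong refl) (simp add: spectrum_eq)
  finally show ?thesis using pow_index[OF assms] by simp
qed

text \<open>Lagrange interpolation of the indicator function of \<open>l\<close> on the spectrum expresses the
  projection as a polynomial in \<open>A\<close>.\<close>

lemma orth_proj_index_eq_sum_pow:
  assumes l: "l \<in> spectrum A"
  shows "\<exists>q. \<forall>i<n. \<forall>j<n. orth_proj n (mat_kernel (l \<cdot>\<^sub>m 1\<^sub>m n - A)) $$ (i,j)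
    = (\<Sum>k\<le>degree q. coeff q k * (A ^\<^sub>m k) $$ (i,j))"
proof -
  define q where "q = (\<Prod>x\<in>spectrum A - {l}. [:- x / (l - x), 1 / (l - x):])"
  have q: "poly q (d m) = (if d m = l then 1 else 0)" if "m < n" for m
  proof (cases "d m = l")
    case True
    then have "poly q (d m) = (\<Prod>x\<in>spectrum A - {l}. (l - x) / (l - x))"
      unfolding q_def poly_prod by (intro prod.cong refl) (simp add: diff_divide_distrib[symmetric])
    also have "\<dots> = 1" by (intro prod.neutral) auto
    finally show ?thesis using True by simp
  next
    case False
    then have "poly q (d m) = 0"
      unfolding q_def poly_prod using that by (intro prod_zero) (auto simp: spectrum_eq)
    then show ?thesis using False by simp
  qed
  have "orth_proj n (mat_kernel (l \<cdot>\<^sub>m 1\<^sub>m n - A)) $$ (i,j)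
      = (\<Sum>k\<le>degree q. coeff q k * (A ^\<^sub>m k) $$ (i,j))" if ij: "i < n" "j < n" for i j
  proof -
    have "(\<Sum>k\<le>degree q. coeff q k * (A ^\<^sub>m k) $$ (i,j))
      = (\<Sum>m<n. \<Sum>k\<le>degree q. coeff q k * (d m ^ k * (P $$ (i,m) * P $$ (j,m))))"
      unfolding pow_index[OF ij] sum_distrib_left by (rule sum.swap)
    also have "\<dots> = (\<Sum>m<n. poly q (d m) * (P $$ (i,m) * P $$ (j,m)))"
      by (simp add: poly_altdef sum_distrib_right mult.assoc)
    also have "\<dots> = orth_proj n (mat_kernel (l \<cdot>\<^sub>m 1\<^sub>m n - A)) $$ (i,j)"
      unfolding orth_proj_kernel_index[OF ij] by (intro sum.cong refl) (simp add: q)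
    finally show ?thesis by simp
  qed
  then show ?thesis by blast
qed

lemma pow_index_eq_iff_orth_proj_index_eq:
  assumes "i < n" "j < n" "i' < n" "j' < n"
  shows "(\<forall>k. (A ^\<^sub>m k) $$ (i,j) = (A ^\<^sub>m k) $$ (i',j')) \<longleftrightarrow>
    (\<forall>l\<in>spectrum A. orth_proj n (mat_kernel (l \<cdot>\<^sub>m 1\<^sub>m n - A)) $$ (i,j)
      = orth_proj n (mat_kernel (l \<cdot>\<^sub>m 1\<^sub>m n - A)) $$ (i',j'))" (is "?pow \<longleftrightarrow> ?proj")
proof
  assume ?pow
  show ?proj
  proof
    fix l assume "l \<in> spectrum A"
    from orth_proj_index_eq_sum_pow[OF this] \<open>?pow\<close> assms
    show "orth_proj n (mat_kernel (l \<cdot>\<^sub>m 1\<^sub>m n - A)) $$ (i,j)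
      = orth_proj n (mat_kernel (l \<cdot>\<^sub>m 1\<^sub>m n - A)) $$ (i',j')" by auto
  qed
next
  assume ?proj
  then show ?pow using assms by (auto simp: pow_index_eq_sum_orth_proj)
qed

end

lemma symmetric_spectral_decomposition:
  fixes A :: "real mat"
  assumes "A \<in> carrier_mat n n" and "transpose_mat A = A"
  obtains P d where "spectral_decomposition A n P d"
  using symmetric_orthogonally_diagonalizable[OF assms] unfolding spectral_decomposition_def by blast

text \<open>By symmetry both polynomials are products of linear factors over their real roots, so no
  information is lost in passing to the roots.\<close>

lemma proots_char_poly_eq_iff:
  fixes A B :: "real mat"
  assumes "A \<in> carrier_mat n n" "transpose_mat A = A" "B \<in> carrier_mat m m" "transpose_mat B = B"
  shows "proots (char_poly A) = proots (char_poly B) \<longleftrightarrow> char_poly A = char_poly B"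
  using assms by (metis symmetric_spectral_decomposition spectral_decomposition.char_poly_proots)

subsection \<open>Adjacency matrices and walks\<close>

text \<open>The explicit list replaces the arbitrary choice in \<open>vert_list\<close>. It may be
  reordered to bring chosen vertices to the front, and a list of only some vertices yields the
  matrix of an induced subgraph.\<close>

definition adj_mat_of :: "('a, 'b) pre_digraph \<Rightarrow> 'a list \<Rightarrow> real mat" where
  "adj_mat_of G vs = mat (length vs) (length vs) (\<lambda>(i,j). if vs ! i \<rightarrow>\<^bsub>G\<^esub> vs ! j then 1 else 0)"

lemma adj_mat_of_carrier [simp]: "adj_mat_of G vs \<in> carrier_mat (length vs) (length vs)"
  by (simp add: adj_mat_of_def)

lemma adj_mat_eq_adj_mat_of: "finite (verts G) \<Longrightarrow> adj_mat G = adj_mat_of G (vert_list G)"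
  by (simp add: adj_mat_def adj_mat_of_def vert_list(3))

lemma transpose_adj_mat_of:
  assumes "symmetric G"
  shows "transpose_mat (adj_mat_of G vs) = adj_mat_of G vs"
  using assms by (intro eq_matI) (auto simp: adj_mat_of_def symmetric_def dest: symD)

lemma index_mult_mat_sum:
  assumes "A \<in> carrier_mat nr n" "B \<in> carrier_mat n nc" "i < nr" "j < nc"
  shows "(A * B) $$ (i,j) = (\<Sum>l<n. A $$ (i,l) * B $$ (l,j))"
  using assms by (simp add: scalar_prod_def atLeast0LessThan)

lemma similar_mat_permute:
  assumes B: "B \<in> carrier_mat n n" and p: "bij_betw p {..<n} {..<n}"
  shows "similar_mat (mat n n (\<lambda>(i,j). B $$ (p i, p j))) (B :: 'a :: field mat)"
proof -
  define P where "P = (mat n n (\<lambda>(i,j). if p i = j then 1 else 0) :: 'a mat)"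
  have P: "P \<in> carrier_mat n n" by (simp add: P_def)
  have pn: "p i < n" if "i < n" for i using bij_betwE[OF p] that by auto
  have inj: "p i = p j \<longleftrightarrow> i = j" if "i < n" "j < n" for i j
    using inj_onD[OF bij_betw_imp_inj_on[OF p]] that by auto
  have PP: "P * transpose_mat P = 1\<^sub>m n"
    by (rule eq_matI) (auto simp: P_def scalar_prod_def if_distrib[of "\<lambda>x. x * _"] pn inj cong: if_cong)
  then have "transpose_mat P * P = 1\<^sub>m n"
    using P mat_mult_left_right_inverse by (metis transpose_carrier_mat)
  moreover have "mat n n (\<lambda>(i,j). B $$ (p i, p j)) = P * B * transpose_mat P"
  proof (rule eq_matI)
    fix i j assume "i < dim_row (P * B * transpose_mat P)" "j < dim_col (P * B * transpose_mat P)"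
    then have ij: "i < n" "j < n" using P by auto
    have PB: "P * B \<in> carrier_mat n n" using P B by auto
    have "(P * B) $$ (i,l) = B $$ (p i, l)" if "l < n" for l
      using that ij P B pn[OF ij(1)]
      by (simp add: P_def scalar_prod_def if_distrib[of "\<lambda>x. x * _"] cong: if_cong)
    then have "(P * B * transpose_mat P) $$ (i,j) = B $$ (p i, p j)"
      using ij P pn[OF ij(2)] index_mult_mat_sum[OF PB, of "transpose_mat P" n i j]
      by (simp add: P_def if_distrib[of "\<lambda>x. _ * x"] cong: if_cong)
    then show "mat n n (\<lambda>(i,j). B $$ (p i, p j)) $$ (i,j) = (P * B * transpose_mat P) $$ (i,j)"
      using ij by simp
  qed (use P in auto)
  ultimately show ?thesis
    using P B PP by (intro similar_matI[of _ _ P "transpose_mat P" n]) auto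
qed

text \<open>Two enumerations of the same vertices give matrices conjugate by a permutation matrix,
  so spectra can be computed with any convenient order.\<close>

lemma char_poly_adj_mat_of_cong:
  assumes "distinct us" "distinct vs" "set us = set vs"
  shows "char_poly (adj_mat_of G us) = char_poly (adj_mat_of G vs)"
proof -
  define n where "n = length vs"
  have n: "length us = n" using assms n_def by (metis distinct_card)
  \<comment> \<open>The permutation sends a position in \<open>us\<close> to the position of the
    same vertex in \<open>vs\<close>.\<close>
  have "bij_betw (\<lambda>i. THE j. j < n \<and> vs ! j = us ! i) {..<n} {..<n} \<and>
      (\<forall>i<n. (THE j. j < n \<and> vs ! j = us ! i) < n \<and> vs ! (THE j. j < n \<and> vs ! j = us ! i) = us ! i)"
    (is "bij_betw ?p _ _ \<and> _")
  proof -
    have p: "?p i < n \<and> vs ! ?p i = us ! i" if "i < n" for i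
    proof (rule theI')
      have "us ! i \<in> set vs" using that n assms(3) by (metis nth_mem)
      then show "\<exists>!j. j < n \<and> vs ! j = us ! i"
        using assms(2) n_def by (metis distinct_Ex1)
    qed
    then have "inj_on ?p {..<n}"
      using assms(1) n by (intro inj_onI) (metis lessThan_iff nth_eq_iff_index_eq)
    moreover have "?p ` {..<n} \<subseteq> {..<n}" using p by auto
    ultimately show ?thesis using p by (simp add: bij_betw_def endo_inj_surj)
  qed
  then obtain p where p: "bij_betw p {..<n} {..<n}" "\<And>i. i < n \<Longrightarrow> p i < n \<and> vs ! p i = us ! i"
    by blast
  have "adj_mat_of G us = mat n n (\<lambda>(i,j). adj_mat_of G vs $$ (p i, p j))"
    by (rule eq_matI) (auto simp: adj_mat_of_def n p(2) n_def[symmetric])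
  then show ?thesis
    using similar_mat_permute[OF _ p(1), of "adj_mat_of G vs"] by (intro char_poly_similar) (simp add: n_def)
qed

text \<open>Walk counts indexed by vertices, hence free of any enumeration, and real so that they
  compare directly with matrix entries. The recursion removes the last arc.\<close>

primrec num_walks :: "('a, 'b) pre_digraph \<Rightarrow> nat \<Rightarrow> 'a \<Rightarrow> 'a \<Rightarrow> real" where
  "num_walks G 0 u v = (if u = v then 1 else 0)"
| "num_walks G (Suc k) u v = (\<Sum>w\<in>verts G. num_walks G k u w * (if w \<rightarrow>\<^bsub>G\<^esub> v then 1 else 0))"

lemma num_walks_nonneg: "num_walks G k u v \<ge> 0"
  by (induction k arbitrary: v) (auto intro!: sum_nonneg)

lemma sum_verts_nth:
  assumes "distinct vs" "set vs = verts G"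
  shows "(\<Sum>w\<in>verts G. f w) = (\<Sum>i<length vs. f (vs ! i))"
  using sum.reindex_bij_betw[OF bij_betw_nth[OF assms(1) refl refl], of f] assms(2) by simp

lemma pow_adj_mat_of_index:
  assumes vs: "distinct vs" "set vs = verts G" and "i < length vs" "j < length vs"
  shows "(adj_mat_of G vs ^\<^sub>m k) $$ (i,j) = num_walks G k (vs ! i) (vs ! j)"
  using assms(3,4)
proof (induction k arbitrary: j)
  case 0
  then show ?case using vs(1) by (simp add: nth_eq_iff_index_eq carrier_matD(1)[OF adj_mat_of_carrier])
next
  case (Suc k)
  have "(adj_mat_of G vs ^\<^sub>m Suc k) $$ (i,j)
      = (\<Sum>l<length vs. (adj_mat_of G vs ^\<^sub>m k) $$ (i,l) * adj_mat_of G vs $$ (l,j))"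
    using Suc.prems index_mult_mat_sum[OF pow_carrier_mat[OF adj_mat_of_carrier] adj_mat_of_carrier]
    by simp
  also have "\<dots> = (\<Sum>l<length vs. num_walks G k (vs ! i) (vs ! l) * (if vs ! l \<rightarrow>\<^bsub>G\<^esub> vs ! j then 1 else 0))"
  proof (intro sum.cong refl)
    fix l assume "l \<in> {..<length vs}"
    moreover from this have "adj_mat_of G vs $$ (l,j) = (if vs ! l \<rightarrow>\<^bsub>G\<^esub> vs ! j then 1 else 0)"
      using Suc.prems by (simp add: adj_mat_of_def)
    ultimately show "(adj_mat_of G vs ^\<^sub>m k) $$ (i,l) * adj_mat_of G vs $$ (l,j)
        = num_walks G k (vs ! i) (vs ! l) * (if vs ! l \<rightarrow>\<^bsub>G\<^esub> vs ! j then 1 else 0)"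
      using Suc.prems by (simp only: Suc.IH lessThan_iff)
  qed
  also have "\<dots> = num_walks G (Suc k) (vs ! i) (vs ! j)"
    by (simp add: sum_verts_nth[OF vs])
  finally show ?case .
qed

lemma vert_index_lt:
  assumes "finite (verts G)" "u \<in> verts G"
  shows "vert_index G u < card (verts G)" "vert_list G ! vert_index G u = u"
proof -
  have "\<exists>!i. i < length (vert_list G) \<and> vert_list G ! i = u"
    using vert_list[OF assms(1)] assms(2) by (metis distinct_Ex1)
  from theI'[OF this] show "vert_index G u < card (verts G)" "vert_list G ! vert_index G u = u"
    unfolding vert_index_def using vert_list(3)[OF assms(1)] by simp_all
qed

lemma entry_pow_adj_mat:
  assumes "finite (verts G)" "u \<in> verts G" "v \<in> verts G"
  shows "entry G (adj_mat G ^\<^sub>m k) u v = num_walks G k u v"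
  unfolding entry_def adj_mat_eq_adj_mat_of[OF assms(1)]
  using vert_index_lt[OF assms(1)] assms vert_list[OF assms(1)] by (simp add: pow_adj_mat_of_index)

subsection \<open>Reversed characteristic polynomials and walk generating functions\<close>

text \<open>The matrix \<open>1 - X A\<close>. Power series entries are used because its inverse,
  the matrix of walk generating functions, exists over them.\<close>

definition rev_char_mat :: "real mat \<Rightarrow> real fps mat" where
  "rev_char_mat A = mat (dim_row A) (dim_row A)
     (\<lambda>(i,j). (if i = j then 1 else 0) - fps_X * fps_const (A $$ (i,j)))"

lemma comm_ring_hom_fps_of_poly: "comm_ring_hom (fps_of_poly :: 'a :: comm_ring_1 poly \<Rightarrow> 'a fps)"
  by unfold_locales (simp_all add: fps_of_poly_add fps_of_poly_mult)

text \<open>For \<open>t \<noteq> 0\<close> the determinant of \<open>1 - t A\<close> is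
  \<open>t ^ n\<close> times the characteristic polynomial at \<open>inverse t\<close>, which is the
  value at \<open>t\<close> of the reflected polynomial. Two polynomials that agree at infinitely
  many points are equal.\<close>

lemma det_rev_char_mat:
  assumes A: "A \<in> carrier_mat n n"
  shows "det (rev_char_mat A) = fps_of_poly (reflect_poly (char_poly A))"
proof -
  \<comment> \<open>The same matrix with polynomial entries, so that it can be evaluated at real
    numbers.\<close>
  define D where "D = mat n n (\<lambda>(i,j). [:if i = j then 1 else 0, - (A $$ (i,j)):])"
  have D: "D \<in> carrier_mat n n" by (simp add: D_def)
  have "map_mat fps_of_poly D = rev_char_mat A"
  proof -
    have "fps_of_poly [:c, - a:] = fps_const c - fps_X * fps_const a" for a c :: real
      by (rule fps_ext) (auto simp: coeff_pCons split: nat.splits)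
    then show ?thesis
      using A by (intro eq_matI) (auto simp: D_def rev_char_mat_def)
  qed
  then have "det (rev_char_mat A) = fps_of_poly (det D)"
    using comm_ring_hom.hom_det[OF comm_ring_hom_fps_of_poly, of D] by simp
  also have "det D = reflect_poly (char_poly A)"
  proof -
    have eq: "poly (det D) t = poly (reflect_poly (char_poly A)) t" if t: "t \<noteq> 0" for t
    proof -
      have "poly (det D) t = det (map_mat (\<lambda>p. poly p t) D)"
        by (rule comm_ring_hom.hom_det[OF poly_hom.comm_ring_hom_axioms, symmetric])
      also have "map_mat (\<lambda>p. poly p t) D = t \<cdot>\<^sub>m (- (char_matrix A (inverse t)))"
        using A t by (intro eq_matI) (auto simp: D_def char_matrix_def field_simps)
      also have "det \<dots> = t ^ n * poly (char_poly A) (inverse t)"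
        using A by (simp add: char_poly_matrix[OF A] char_matrix_def)
      also have "\<dots> = poly (reflect_poly (char_poly A)) t"
        using t degree_monic_char_poly[OF A] by (simp add: poly_reflect_poly_nz)
      finally show ?thesis .
    qed
    have "infinite {t. poly (det D - reflect_poly (char_poly A)) t = 0}"
    proof (rule infinite_super)
      show "- {0} \<subseteq> {t. poly (det D - reflect_poly (char_poly A)) t = 0}" using eq by auto
      show "infinite (- {0 :: real})" using infinite_UNIV_char_0 by (simp add: Compl_eq_Diff_UNIV)
    qed
    then have "det D - reflect_poly (char_poly A) = 0" using poly_roots_finite by blast
    then show ?thesis by simp
  qed
  finally show ?thesis .
qed

text \<open>Reflection forgets factors \<open>X\<close>, and the degree restores them. For
  characteristic polynomials the degree is the size of the matrix.\<close>

lemma reflect_poly_cancel: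
  fixes p q :: "'a :: zero poly"
  assumes "degree p = degree q" "reflect_poly p = reflect_poly q"
  shows "p = q"
proof (rule poly_eqI)
  fix i
  show "coeff p i = coeff q i"
  proof (cases "i \<le> degree p")
    case True
    moreover have "coeff r i = coeff (reflect_poly r) (degree r - i)" if "i \<le> degree r" for r :: "'a poly"
      using that by (auto simp: coeff_reflect_poly)
    ultimately show ?thesis using assms by metis
  next
    case False
    then show ?thesis using assms(1) by (simp add: coeff_eq_0)
  qed
qed

definition walk_gf :: "('a, 'b) pre_digraph \<Rightarrow> 'a \<Rightarrow> 'a \<Rightarrow> real fps" where
  "walk_gf G u v = Abs_fps (\<lambda>k. num_walks G k u v)"

lemma walk_gf_nth [simp]: "fps_nth (walk_gf G u v) k = num_walks G k u v"
  by (simp add: walk_gf_def)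

text \<open>Splitting off the last arc: the entrywise form of \<open>W = 1 + X W A\<close>, that is
  \<open>W (1 - X A) = 1\<close>.\<close>

lemma walk_gf_rec:
  "walk_gf G u v = (if u = v then 1 else 0) +
    fps_X * (\<Sum>w\<in>verts G. walk_gf G u w * fps_const (if w \<rightarrow>\<^bsub>G\<^esub> v then 1 else 0))"
proof (rule fps_ext)
  fix k
  show "fps_nth (walk_gf G u v) k = fps_nth ((if u = v then 1 else 0) +
    fps_X * (\<Sum>w\<in>verts G. walk_gf G u w * fps_const (if w \<rightarrow>\<^bsub>G\<^esub> v then 1 else 0))) k"
    by (cases k) (auto simp: fps_sum_nth)
qed



text \<open>The principal block of the inverse of \<open>1 - X A\<close> at the vertices in
  \<open>us\<close>.\<close>

definition walk_gf_mat :: "('a, 'b) pre_digraph \<Rightarrow> 'a list \<Rightarrow> real fps mat" where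
  "walk_gf_mat G us = mat (length us) (length us) (\<lambda>(i,j). walk_gf G (us ! i) (us ! j))"

text \<open>Jacobi's identity for complementary minors: the walk generating functions are the
  entries of the inverse of \<open>1 - X A\<close>.\<close>

lemma det_rev_char_mat_append:
  assumes vs: "distinct (us @ ws)" "set (us @ ws) = verts G"
  shows "det (rev_char_mat (adj_mat_of G ws))
    = det (walk_gf_mat G us) * det (rev_char_mat (adj_mat_of G (us @ ws)))"
proof -
  let ?vs = "us @ ws"
  define k where "k = length us"
  define m where "m = length ws"
  define M where "M = rev_char_mat (adj_mat_of G ?vs)"
  \<comment> \<open>The first \<open>k\<close> rows are those of the inverse of \<open>M\<close>,
    the others those of the identity. Thus \<open>W\<close> is block upper triangular and
    \<open>W * M\<close> block lower triangular, and comparing determinants gives the claim.\<close>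
  define W where "W = mat (k + m) (k + m)
    (\<lambda>(i,j). if i < k then walk_gf G (?vs ! i) (?vs ! j) else if i = j then 1 else 0)"
  have M: "M \<in> carrier_mat (k + m) (k + m)"
    by (simp add: M_def rev_char_mat_def adj_mat_of_def k_def m_def)
  have W: "W \<in> carrier_mat (k + m) (k + m)" by (simp add: W_def)
  have M_index: "M $$ (i,j) = (if i = j then 1 else 0) - fps_X * fps_const (if ?vs ! i \<rightarrow>\<^bsub>G\<^esub> ?vs ! j then 1 else 0)"
    if "i < k + m" "j < k + m" for i j
    using that by (simp add: M_def rev_char_mat_def adj_mat_of_def k_def m_def)
  define M21 where "M21 = mat m k (\<lambda>(i,j). M $$ (i + k, j))"
  have WM: "W * M = four_block_mat (1\<^sub>m k) (0\<^sub>m k m) M21 (rev_char_mat (adj_mat_of G ws))"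
    (is "_ = ?R")
  proof (rule eq_matI)
    fix i j assume "i < dim_row ?R" "j < dim_col ?R"
    then have ij: "i < k + m" "j < k + m"
      by (auto simp: M21_def rev_char_mat_def adj_mat_of_def m_def)
    have WMij: "(W * M) $$ (i,j) = (\<Sum>l<k + m. W $$ (i,l) * M $$ (l,j))"
      using ij W M by (simp add: scalar_prod_def atLeast0LessThan)
    show "(W * M) $$ (i,j) = ?R $$ (i,j)"
    proof (cases "i < k")
      case True
      let ?u = "?vs ! i" and ?v = "?vs ! j"
      have "(W * M) $$ (i,j) = (\<Sum>l<k + m. (if l = j then walk_gf G ?u (?vs ! l) else 0)
          - fps_X * (walk_gf G ?u (?vs ! l) * fps_const (if ?vs ! l \<rightarrow>\<^bsub>G\<^esub> ?v then 1 else 0)))"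
        unfolding WMij using ij True by (intro sum.cong refl) (auto simp: W_def M_index algebra_simps)
      also have "\<dots> = walk_gf G ?u ?v - fps_X * (\<Sum>w\<in>verts G. walk_gf G ?u w * fps_const (if w \<rightarrow>\<^bsub>G\<^esub> ?v then 1 else 0))"
        using ij sum_verts_nth[OF vs, of "\<lambda>w. walk_gf G ?u w * fps_const (if w \<rightarrow>\<^bsub>G\<^esub> ?v then 1 else 0)"]
        by (simp add: sum_subtractf sum_distrib_left[symmetric] k_def m_def)
      also have "\<dots> = (if ?u = ?v then 1 else 0)"
        by (subst walk_gf_rec) simp
      also have "?u = ?v \<longleftrightarrow> i = j"
        using vs(1) ij by (intro nth_eq_iff_index_eq) (auto simp: k_def m_def)
      finally show ?thesis using True ij by (simp add: M21_def rev_char_mat_def adj_mat_of_def m_def)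
    next
      case False
      have "(W * M) $$ (i,j) = (\<Sum>l<k + m. if l = i then M $$ (l,j) else 0)"
        unfolding WMij using ij False by (intro sum.cong refl) (auto simp: W_def)
      also have "\<dots> = M $$ (i,j)" using ij by simp
      finally show ?thesis using False ij
        by (auto simp: M21_def M_index rev_char_mat_def adj_mat_of_def m_def k_def nth_append)
    qed
  qed (use W M in \<open>auto simp: M21_def rev_char_mat_def adj_mat_of_def m_def\<close>)
  have "W = four_block_mat (walk_gf_mat G us) (mat k m (\<lambda>(i,j). W $$ (i, j + k))) (0\<^sub>m m k) (1\<^sub>m m)"
    by (rule eq_matI) (auto simp: W_def walk_gf_mat_def k_def m_def nth_append)
  then have "det W = det (walk_gf_mat G us) * det (1\<^sub>m m)"
    by (metis det_four_block_mat_lower_left_zero mat_carrier one_carrier_mat k_def walk_gf_mat_def)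
  moreover have "det (W * M) = det (1\<^sub>m k) * det (rev_char_mat (adj_mat_of G ws))"
    unfolding WM by (rule det_four_block_mat_upper_right_zero[of _ k _ m])
      (auto simp: M21_def rev_char_mat_def adj_mat_of_def m_def)
  ultimately show ?thesis using det_mult[OF W M] by (simp add: M_def)
qed

section \<open>Symmetry and positivity of walk counts, and distance\<close>

lemma num_walks_sym:
  assumes "finite (verts G)" "symmetric G" "u \<in> verts G" "v \<in> verts G"
  shows "num_walks G k u v = num_walks G k v u"
proof -
  note vl = vert_list[OF assms(1)]
  obtain P d where "spectral_decomposition (adj_mat_of G (vert_list G)) (card (verts G)) P d"
    using symmetric_spectral_decomposition[OF adj_mat_of_carrier transpose_adj_mat_of[OF assms(2)]] vl(3)
    by metis
  \<comment> \<open>The formula \<open>pow_index\<close> is symmetric in \<open>i\<close> and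
    \<open>j\<close>.\<close>
  then have "(adj_mat_of G (vert_list G) ^\<^sub>m k) $$ (i,j) = (adj_mat_of G (vert_list G) ^\<^sub>m k) $$ (j,i)"
    if "i < card (verts G)" "j < card (verts G)" for i j
    using that by (simp add: spectral_decomposition.pow_index mult.commute)
  then show ?thesis
    using vert_index_lt[OF assms(1)] assms(3,4) pow_adj_mat_of_index[OF vl(1,2)] vl(3) by metis
qed

text \<open>Induction on the walk from its end: in the recursion for the count, the summand at the
  tail of the last arc is positive and the others are nonnegative.\<close>

lemma num_walks_pos:
  assumes "wf_digraph G" "finite (verts G)" "pre_digraph.awalk G u p v"
  shows "num_walks G (length p) u v > 0"
  using assms(3)
proof (induction p arbitrary: v rule: rev_induct)
  case Nil
  then show ?case by (simp add: pre_digraph.awalk_def pre_digraph.cas.simps)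
next
  case (snoc a p)
  interpret wf_digraph G by fact
  have p: "awalk u p (tail G a)" and a: "a \<in> arcs G" "head G a = v"
    using snoc.prems by (auto simp: awalk_append_iff awalk_simps)
  have "tail G a \<in> verts G" "tail G a \<rightarrow>\<^bsub>G\<^esub> v" using a by (auto intro: in_arcs_imp_in_arcs_ends)
  then show ?case using snoc.IH[OF p] assms(2)
    by (auto intro!: sum_pos2[of _ "tail G a"] simp: num_walks_nonneg)
qed

text \<open>A finite distance means that the second vertex is reachable, so the distance is attained
  by a walk, whose cost for unit weights is its length. This walk makes the count for length
  \<open>h\<close> positive, which later excludes a change of sign.\<close>

lemma pairs_at_distD:
  assumes "fin_digraph G" "(u, v) \<in> pairs_at_dist G h"
  shows "u \<in> verts G" "v \<in> verts G" "num_walks G h u v > 0" "u = v \<longleftrightarrow> h = 0"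
proof -
  interpret fin_digraph G by fact
  show uv: "u \<in> verts G" "v \<in> verts G" using assms(2) by (auto simp: pairs_at_dist_def)
  have cost: "awalk_cost (\<lambda>_. 1) p = real (length p)" for p :: "'b list"
    by (induction p) auto
  have dist: "\<mu> (\<lambda>_. 1) u v = ereal (real h)"
    using assms(2) by (simp add: pairs_at_dist_def vdist_def)
  have "u \<rightarrow>\<^sup>*\<^bsub>G\<^esub> v"
  proof (rule ccontr)
    assume "\<not> u \<rightarrow>\<^sup>*\<^bsub>G\<^esub> v"
    from shortest_path_inf[OF this] dist show False by simp
  qed
  from min_cost_awalk[OF this, of "\<lambda>_. 1"] obtain p
    where p: "apath u p v" "\<mu> (\<lambda>_. 1) u v = awalk_cost (\<lambda>_. 1) p" by auto
  then have len: "length p = h" using dist cost by simp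
  have "awalk u p v" using p(1) by (rule awalkI_apath)
  then show "num_walks G h u v > 0"
    using num_walks_pos[OF wf_digraph_axioms] len by auto
  show "u = v \<longleftrightarrow> h = 0"
  proof
    assume "u = v"
    then have "awalk u [] v" using uv by (simp add: awalk_Nil_iff)
    from min_cost_le_walk_cost[OF this, of "\<lambda>_. 1"] show "h = 0" using dist by simp
  next
    assume "h = 0"
    then show "u = v" using len \<open>awalk u p v\<close> by (simp add: awalk_Nil_iff)
  qed
qed

subsection \<open>Vertex-deleted subgraphs\<close>

lemma verts_del_two: "verts (del_two G u v) = verts G - {u, v}"
  by (auto simp: del_two_def pre_digraph.verts_del_vert)

lemma dominates_del_two:
  "x \<rightarrow>\<^bsub>del_two G u v\<^esub> y \<longleftrightarrow> x \<rightarrow>\<^bsub>G\<^esub> y \<and> {x, y} \<inter> {u, v} = {}"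
  by (auto simp: del_two_def arcs_ends_def arc_to_ends_def pre_digraph.del_vert_simps)

lemma sp_del_two:
  assumes "finite (verts G)" "distinct ws" "set ws = verts G - {u, v}"
  shows "sp (del_two G u v) = proots (char_poly (adj_mat_of G ws))"
proof -
  let ?H = "del_two G u v"
  have fin: "finite (verts ?H)" using assms(1) by (simp add: verts_del_two)
  have ws: "ws ! i \<notin> {u, v}" if "i < length ws" for i
    using nth_mem[OF that] assms(3) by auto
  have "adj_mat_of ?H ws = adj_mat_of G ws"
    by (rule eq_matI) (use ws in \<open>auto simp: adj_mat_of_def dominates_del_two\<close>)
  moreover have "char_poly (adj_mat_of ?H (vert_list ?H)) = char_poly (adj_mat_of ?H ws)"
    using vert_list[OF fin] assms by (intro char_poly_adj_mat_of_cong) (auto simp: verts_del_two)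
  ultimately show ?thesis by (simp add: sp_def adj_mat_eq_adj_mat_of[OF fin])
qed

section \<open>Deleted pairs and cospectrality\<close>

lemma det_two:
  assumes "A \<in> carrier_mat 2 2"
  shows "det A = A $$ (0,0) * A $$ (1,1) - A $$ (0,1) * A $$ (1,0)"
proof -
  have "det A = (\<Sum>i<2. A $$ (i,0) * cofactor A i 0)"
    using assms by (intro laplace_expansion_column) auto
  also have "\<dots> = A $$ (0,0) * cofactor A 0 0 + A $$ (1,0) * cofactor A 1 0"
    by (simp add: numeral_2_eq_2)
  finally have "det A = A $$ (0,0) * cofactor A 0 0 + A $$ (1,0) * cofactor A 1 0" .
  moreover have "mat_delete A i 0 \<in> carrier_mat 1 1" for i
    using mat_delete_carrier[OF assms, of i 0] by simp
  then have "cofactor A 0 0 = A $$ (1,1)" "cofactor A 1 0 = - A $$ (0,1)"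
    using assms by (auto simp: cofactor_def det_single mat_delete_def)
  ultimately show ?thesis by simp
qed

text \<open>The determinant of \<open>walk_gf_mat\<close> at the list of deleted vertices, which has
  one entry if \<open>u = v\<close> and two otherwise.\<close>

definition del_gf :: "('a, 'b) pre_digraph \<Rightarrow> 'a \<Rightarrow> 'a \<Rightarrow> real fps" where
  "del_gf G u v = (if u = v then walk_gf G u u
     else walk_gf G u u * walk_gf G v v - walk_gf G u v * walk_gf G v u)"

text \<open>The identity for complementary minors, with the deleted vertices placed first and the
  remaining ones after them.\<close>

lemma char_poly_del:
  assumes "finite (verts G)" "u \<in> verts G" "v \<in> verts G" "distinct ws" "set ws = verts G - {u, v}"
  shows "fps_of_poly (reflect_poly (char_poly (adj_mat_of G ws)))
    = del_gf G u v * fps_of_poly (reflect_poly (char_poly (adj_mat G)))"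
proof -
  define us where "us = (if u = v then [u] else [u, v])"
  have vs: "distinct (us @ ws)" "set (us @ ws) = verts G" using assms by (auto simp: us_def)
  have "det (walk_gf_mat G us) = del_gf G u v"
  proof (cases "u = v")
    case True
    then show ?thesis by (subst det_single) (auto simp: us_def walk_gf_mat_def del_gf_def)
  next
    case False
    then show ?thesis by (subst det_two) (auto simp: us_def walk_gf_mat_def del_gf_def numeral_2_eq_2)
  qed
  moreover have "char_poly (adj_mat G) = char_poly (adj_mat_of G (us @ ws))"
    unfolding adj_mat_eq_adj_mat_of[OF assms(1)]
    using vert_list[OF assms(1)] vs by (intro char_poly_adj_mat_of_cong) auto
  ultimately show ?thesis
    using det_rev_char_mat_append[OF vs] by (simp add: det_rev_char_mat[OF adj_mat_of_carrier])
qed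

text \<open>Equal spectra mean equal characteristic polynomials. As equally many vertices remain,
  these have equal degree, so they may be compared after reflection; there the common nonzero factor
  coming from \<open>G\<close> cancels.\<close>

lemma cospectral_iff_del_gf_eq:
  assumes fin: "finite (verts G)" and sym: "symmetric G"
    and "u \<in> verts G" "v \<in> verts G" "w \<in> verts G" "z \<in> verts G" and eq: "u = v \<longleftrightarrow> w = z"
  shows "sp (del_two G u v) = sp (del_two G w z) \<longleftrightarrow> del_gf G u v = del_gf G w z"
proof -
  obtain xs where xs: "distinct xs" "set xs = verts G - {u, v}"
    using fin finite_distinct_list[of "verts G - {u, v}"] by auto
  obtain ys where ys: "distinct ys" "set ys = verts G - {w, z}"
    using fin finite_distinct_list[of "verts G - {w, z}"] by auto
  have "card {u, v} = card {w, z}" using eq by (cases "u = v") auto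
  then have "card (verts G - {u, v}) = card (verts G - {w, z})"
    using assms by (simp add: card_Diff_subset)
  then have len: "length xs = length ys" using xs ys by (metis distinct_card)
  let ?p = "char_poly (adj_mat_of G xs)" and ?q = "char_poly (adj_mat_of G ys)"
  let ?r = "reflect_poly (char_poly (adj_mat G))"
  have "adj_mat G \<in> carrier_mat (card (verts G)) (card (verts G))" by (simp add: adj_mat_def)
  from degree_monic_char_poly[OF this] have "char_poly (adj_mat G) \<noteq> 0" by auto
  then have r: "fps_of_poly ?r \<noteq> 0" using fps_of_poly_eq_iff[of ?r 0] by simp
  have "sp (del_two G u v) = sp (del_two G w z) \<longleftrightarrow> proots ?p = proots ?q"
    by (simp add: sp_del_two[OF fin xs] sp_del_two[OF fin ys])
  also have "\<dots> \<longleftrightarrow> ?p = ?q"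
    by (rule proots_char_poly_eq_iff[OF adj_mat_of_carrier _ adj_mat_of_carrier])
      (rule transpose_adj_mat_of[OF sym])+
  also have "\<dots> \<longleftrightarrow> reflect_poly ?p = reflect_poly ?q"
  proof -
    have "degree ?p = degree ?q"
      using degree_monic_char_poly[OF adj_mat_of_carrier, of G] len by simp
    then show ?thesis by (metis reflect_poly_cancel)
  qed
  also have "\<dots> \<longleftrightarrow> fps_of_poly (reflect_poly ?p) = fps_of_poly (reflect_poly ?q)"
    by (simp add: fps_of_poly_eq_iff)
  also have "\<dots> \<longleftrightarrow> del_gf G u v = del_gf G w z"
    unfolding char_poly_del[OF fin assms(3,4) xs] char_poly_del[OF fin assms(5,6) ys]
    using r by (rule mult_right_cancel)
  finally show ?thesis .
qed

text \<open>Walk-regularity makes all diagonal series equal, so for distinct vertices cospectrality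
  says that the squares of the two off-diagonal series agree. It remains to rule out opposite
  signs.\<close>

lemma walk_gf_eq_iff_cospectral:
  assumes G: "graph G" and reg: "walk_regular G"
    and uv: "(u, v) \<in> pairs_at_dist G h" and wz: "(w, z) \<in> pairs_at_dist G h"
  shows "walk_gf G u v = walk_gf G w z \<longleftrightarrow> sp (del_two G u v) = sp (del_two G w z)"
proof -
  interpret graph G by fact
  note uvD = pairs_at_distD[OF fin_digraph_axioms uv] and wzD = pairs_at_distD[OF fin_digraph_axioms wz]
  have fin: "finite (verts G)" by simp
  have diag: "walk_gf G x x = walk_gf G y y" if "x \<in> verts G" "y \<in> verts G" for x y
  proof (rule fps_ext)
    fix k
    have "entry G (adj_mat G ^\<^sub>m k) x x = entry G (adj_mat G ^\<^sub>m k) y y"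
      using reg that unfolding walk_regular_def by blast
    then show "fps_nth (walk_gf G x x) k = fps_nth (walk_gf G y y) k"
      using that by (simp add: entry_pow_adj_mat[OF fin])
  qed
  have sym: "walk_gf G x y = walk_gf G y x" if "x \<in> verts G" "y \<in> verts G" for x y
    using that by (intro fps_ext) (simp add: num_walks_sym[OF fin sym_arcs])
  have cosp: "sp (del_two G u v) = sp (del_two G w z) \<longleftrightarrow> del_gf G u v = del_gf G w z"
    by (rule cospectral_iff_del_gf_eq) (use uvD wzD fin sym_arcs in auto)
  show ?thesis
  proof (cases "h = 0")
    \<comment> \<open>Here both sides of the equivalence hold: all diagonal series coincide.\<close>
    case True
    then have "u = v" "w = z" using uvD wzD by auto
    then show ?thesis using cosp diag[of u w] uvD wzD by (simp add: del_gf_def)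
  next
    case False
    then have "u \<noteq> v" "w \<noteq> z" using uvD wzD by auto
    have "del_gf G u v = del_gf G w z \<longleftrightarrow> walk_gf G u v * walk_gf G u v = walk_gf G w z * walk_gf G w z"
      using \<open>u \<noteq> v\<close> \<open>w \<noteq> z\<close> uvD wzD diag[of u w] diag[of v w] diag[of z w] sym[of v u] sym[of z w]
      by (simp add: del_gf_def)
    also have "\<dots> \<longleftrightarrow> walk_gf G u v = walk_gf G w z \<or> walk_gf G u v = - walk_gf G w z"
      by (rule square_eq_iff)
    finally have "del_gf G u v = del_gf G w z \<longleftrightarrow> \<dots>" .
    \<comment> \<open>The coefficients of \<open>X ^ h\<close> in both series are positive, since
      both pairs are joined by a walk of length \<open>h\<close>.\<close>
    moreover have "walk_gf G u v \<noteq> - walk_gf G w z"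
    proof
      assume "walk_gf G u v = - walk_gf G w z"
      then have "num_walks G h u v = - num_walks G h w z"
        by (metis fps_neg_nth walk_gf_nth)
      then show False using uvD(3) wzD(3) by simp
    qed
    ultimately show ?thesis using cosp by simp
  qed
qed

theorem theorem4p2:
  fixes G :: "('a, 'b) pre_digraph" and h :: nat
  assumes "graph G" and "connected G" and "walk_regular G"
    and "ereal (real h) \<le> diam G"
  shows "(punctually_walk_regular h G \<longleftrightarrow> punctually_spectrum_regular h G) \<and>
         (punctually_spectrum_regular h G \<longleftrightarrow> punctually_cospectral h G)"
proof -
  interpret graph G by fact
  have fin: "finite (verts G)" by simp
  let ?D = "pairs_at_dist G h" and ?n = "card (verts G)"
  have A: "adj_mat G \<in> carrier_mat ?n ?n" by (simp add: adj_mat_def)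
  have At: "transpose_mat (adj_mat G) = adj_mat G"
    unfolding adj_mat_eq_adj_mat_of[OF fin] by (rule transpose_adj_mat_of[OF sym_arcs])
  obtain P d where sd: "spectral_decomposition (adj_mat G) ?n P d"
    using symmetric_spectral_decomposition[OF A At] by blast
  have walk: "(\<forall>k. entry G (adj_mat G ^\<^sub>m k) u v = entry G (adj_mat G ^\<^sub>m k) w z)
      \<longleftrightarrow> walk_gf G u v = walk_gf G w z"
    if "(u, v) \<in> ?D" "(w, z) \<in> ?D" for u v w z
    using pairs_at_distD[OF fin_digraph_axioms that(1)] pairs_at_distD[OF fin_digraph_axioms that(2)]
    by (simp add: entry_pow_adj_mat[OF fin] fps_eq_iff)
  have proj: "(\<forall>k. entry G (adj_mat G ^\<^sub>m k) u v = entry G (adj_mat G ^\<^sub>m k) w z)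
      \<longleftrightarrow> (\<forall>l\<in>spectrum (adj_mat G). entry G (eigenproj G l) u v = entry G (eigenproj G l) w z)"
    if "(u, v) \<in> ?D" "(w, z) \<in> ?D" for u v w z
    unfolding entry_def eigenproj_def
    by (rule spectral_decomposition.pow_index_eq_iff_orth_proj_index_eq[OF sd])
      (use that pairs_at_distD[OF fin_digraph_axioms] vert_index_lt[OF fin] in blast)+
  \<comment> \<open>Moving the quantifier over lengths inside those over pairs allows the
    equivalences for two fixed pairs to be applied; the eigenvalues are treated in the same way
    below.\<close>
  have "punctually_walk_regular h G \<longleftrightarrow> (\<forall>(u, v)\<in>?D. \<forall>(w, z)\<in>?D.
      \<forall>k. entry G (adj_mat G ^\<^sub>m k) u v = entry G (adj_mat G ^\<^sub>m k) w z)"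
    unfolding punctually_walk_regular_def by fast
  also have "\<dots> \<longleftrightarrow> (\<forall>(u, v)\<in>?D. \<forall>(w, z)\<in>?D. walk_gf G u v = walk_gf G w z)"
    by (simp add: walk Ball_def split_paired_All cong: imp_cong)
  also have "\<dots> \<longleftrightarrow> punctually_cospectral h G"
    unfolding punctually_cospectral_def
    by (simp add: walk_gf_eq_iff_cospectral[OF assms(1,3)] Ball_def split_paired_All cong: imp_cong)
  finally have cosp: "punctually_walk_regular h G \<longleftrightarrow> punctually_cospectral h G" .
  have "punctually_spectrum_regular h G \<longleftrightarrow> (\<forall>(u, v)\<in>?D. \<forall>(w, z)\<in>?D.
      \<forall>l\<in>spectrum (adj_mat G). entry G (eigenproj G l) u v = entry G (eigenproj G l) w z)"
    unfolding punctually_spectrum_regular_def by fast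
  also have "\<dots> \<longleftrightarrow> (\<forall>(u, v)\<in>?D. \<forall>(w, z)\<in>?D.
      \<forall>k. entry G (adj_mat G ^\<^sub>m k) u v = entry G (adj_mat G ^\<^sub>m k) w z)"
    by (simp add: proj Ball_def[of ?D] split_paired_All cong: imp_cong)
  also have "\<dots> \<longleftrightarrow> punctually_walk_regular h G"
    unfolding punctually_walk_regular_def by fast
  finally show ?thesis using cosp by simp
qed

end
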